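(* Let $X_t\in\mathbb{R}^{n\times d_x}$ and $X_s\in\mathbb{R}^{m\times d_x}$, and let $\mathcal{L}_{\text{SSL}}$, $\theta^*(X_s)$, $\hat\theta(X_s)$ and $\zeta=(\zeta_i)_{i=1}^r$ be as defined in the context. Then the derivative $\frac{\partial \mathcal{L}_{\text{SSL}}(\hat\theta(X_s);X_t)}{\partial X_s}$ is a biased estimator of $\frac{\partial \mathcal{L}_{\text{SSL}}(\theta^*(X_s);X_t)}{\partial X_s}$, i.e. $$\mathbb{E}_\zeta\left[\frac{\partial \mathcal{L}_{\text{SSL}}(\hat\theta(X_s);X_t)}{\partial X_s}\right]\neq \frac{\partial \mathcal{L}_{\text{SSL}}(\theta^*(X_s);X_t)}{\partial X_s},$$ unless, for all $(i,j)\in\{1,\dots,m\}\times\{1,\dots,d_x\}$, $$\left(\frac{\partial \mathcal{L}_{\text{SSL}}(\theta;X_t)}{\partial\theta}\Big|_{\theta=\theta^*(X_s)}\right)\frac{\partial\theta^*(X_s)}{\partial (X_s)_{ij}}=\mathbb{E}_\zeta\left[\frac{\partial \mathcal{L}_{\text{SSL}}(\theta;X_t)}{\partial\theta}\Big|_{\theta=\hat\theta(X_s)}\right]\mathbb{E}_\zeta\left[\frac{\partial\hat\theta(X_s)}{\partial (X_s)_{ij}}\right]+\sum_{k=1}^{d_\theta}\operatorname{Cov}_\zeta\left[\frac{\partial \mathcal{L}_{\text{SSL}}(\theta;X_t)}{\partial\theta_k}\Big|_{\theta=\hat\theta(X_s)},\ \frac{\partial\hat\theta(X_s)_k}{\partial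 (X_s)_{ij}}\right].$$ That is, if this equality fails for at least one pair $(i,j)$, then the two displayed $m\times d_x$ matrices (the expected derivative and the true derivative) are not equal.
   Context: Setting: $n,m,d_x,d_\theta,r$ are positive integers. $X_t\in\mathbb{R}^{n\times d_x}$ (the full dataset) is fixed; $X_s\in\mathbb{R}^{m\times d_x}$ is the synthetic dataset, with entries $(X_s)_{ij}$. Model parameters are $\theta\in\mathbb{R}^{d_\theta}$. $\mathcal{D}$ is a probability distribution (of random data augmentations or input masks). For each outcome $\xi$ of $\mathcal{D}$, $\ell_\xi(\theta,X)\in\mathbb{R}$ is a loss function of the parameter $\theta\in\mathbb{R}^{d_\theta}$ and a dataset $X$ (a real matrix with $d_x$ columns and any number of rows). The true loss is $$\mathcal{L}_{\text{SSL}}(\theta;X)=\mathbb{E}_{\xi\sim\mathcal{D}}[\ell_\xi(\theta,X)],$$ and $\theta^*(X_s)=\arg\min_\theta \mathcal{L}_{\text{SSL}}(\theta;X_s)$. $\zeta=(\zeta_i)_{i=1}^r$ with each $\zeta_i\sim\mathcal{D}$. The empirical loss is $$\hat{\mathcal{L}}_{\text{SSL}}(\theta;X_s)=\frac1r\sum_{i=1}^r\ell_{\zeta_i}(\theta,X_s),$$ and $\hat\theta(X_s)=\arg\min_\theta\hat{\mathcal{L}}_{\text{SSL}}(\theta;X_s)$; it depends on the random $\zeta$. Here $\theta^*(\cdot)$ and $\hat\theta(\cdot)$ are treated as functions of the dataset $X_s$ with values in $\mathbb{R}^{d_\theta}$ (for $\hat\theta$, for each realization of $\zeta$). Notation: $\mathbb{E}_\zeta$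 and $\operatorname{Cov}_\zeta$ are expectation and covariance over $\zeta$, with $\operatorname{Cov}_\zeta[a,b]=\mathbb{E}_\zeta[ab]-\mathbb{E}_\zeta[a]\mathbb{E}_\zeta[b]$. The subscript $k$ denotes the $k$-th coordinate in $\mathbb{R}^{d_\theta}$. $\frac{\partial\mathcal{L}_{\text{SSL}}(\theta;X_t)}{\partial\theta}$ is a row vector in $\mathbb{R}^{1\times d_\theta}$, and $\frac{\partial\theta^*(X_s)}{\partial(X_s)_{ij}}$, $\frac{\partial\hat\theta(X_s)}{\partial(X_s)_{ij}}$ are column vectors in $\mathbb{R}^{d_\theta}$. $\frac{\partial \mathcal{L}_{\text{SSL}}(\theta^*(X_s);X_t)}{\partial X_s}$ denotes the $m\times d_x$ matrix of partial derivatives, with respect to the entries $(X_s)_{ij}$, of the composite function $X_s\mapsto\mathcal{L}_{\text{SSL}}(\theta^*(X_s);X_t)$, and likewise with $\hat\theta$ in place of $\theta^*$. Expectations of vectors and matrices are taken entrywise. Implicit regularity: the minimizers exist and are (chosen to be) well-defined functions; $\theta\mapsto\mathcal{L}_{\text{SSL}}(\theta;X_t)$ is differentiable at $\theta^*(X_s)$ and at $\hat\theta(X_s)$ for every realization of $\zeta$; $\theta^*$ and (for every realization of $\zeta$) $\hat\theta$ are differentiable at $X_s$; for each $k,i,j$ the random variables $\frac{\partial \mathcal{L}_{\text{SSL}}(\theta;X_t)}{\partial\theta_k}|_{\theta=\hat\theta(X_s)}$, $\frac{\partial\hat\theta(X_s)_k}{\partial(X_s)_{ij}}$ and their product are integrable.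 *)

theory Defs
  imports "HOL-Probability.Probability"
begin

(* A loss has to accept datasets with any number of rows, so its dataset argument is the list
   of rows. The linear order on the index type fixes the enumeration 1..m of the rows. *)
definition row_list :: "'a^'m::{finite,linorder} \<Rightarrow> 'a list" where
  "row_list X = map (\<lambda>i. X $ i) (sorted_list_of_set UNIV)"

definition ssl_loss ::
  "'x measure \<Rightarrow> ('x \<Rightarrow> 'p \<Rightarrow> 'd list \<Rightarrow> real) \<Rightarrow> 'p \<Rightarrow> 'd list \<Rightarrow> real" where
  "ssl_loss D loss \<theta> X = (\<integral>\<xi>. loss \<xi> \<theta> X \<partial>D)"

definition emp_loss ::
  "('r::finite \<Rightarrow> 'x) \<Rightarrow> ('x \<Rightarrow> 'p \<Rightarrow> 'd list \<Rightarrow> real) \<Rightarrow> 'p \<Rightarrow> 'd list \<Rightarrow> real" where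
  "emp_loss z loss \<theta> X = (1 / real CARD('r)) * (\<Sum>i\<in>UNIV. loss (z i) \<theta> X)"

(* The partial derivative of f at x with respect to the coordinate whose unit vector is b. *)
definition partial_deriv :: "('a::real_vector \<Rightarrow> 'b::real_normed_vector) \<Rightarrow> 'a \<Rightarrow> 'a \<Rightarrow> 'b" where
  "partial_deriv f x b = vector_derivative (\<lambda>t. f (x + t *\<^sub>R b)) (at 0)"

definition vec_partial :: "(real^'k \<Rightarrow> real) \<Rightarrow> real^'k \<Rightarrow> 'k::finite \<Rightarrow> real" where
  "vec_partial f x k = partial_deriv f x (axis k 1)"

definition entry_partial ::
  "(real^'c^'m \<Rightarrow> 'b::real_normed_vector) \<Rightarrow> real^'c^'m \<Rightarrow> 'm::finite \<Rightarrow> 'c::finite \<Rightarrow> 'b" where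
  "entry_partial f X i j = partial_deriv f X (axis i (axis j 1))"

definition row_gradient :: "(real^'k \<Rightarrow> real) \<Rightarrow> real^'k \<Rightarrow> real^'k::finite" where
  "row_gradient f x = (\<chi> k. vec_partial f x k)"

definition mat_gradient :: "(real^'c^'m \<Rightarrow> real) \<Rightarrow> real^'c^'m \<Rightarrow> real^'c::finite^'m::finite" where
  "mat_gradient f X = (\<chi> i j. entry_partial f X i j)"

definition vec_expectation :: "'w measure \<Rightarrow> ('w \<Rightarrow> real^'k) \<Rightarrow> real^'k::finite" where
  "vec_expectation M V = (\<chi> k. \<integral>\<omega>. V \<omega> $ k \<partial>M)"

definition mat_expectation :: "'w measure \<Rightarrow> ('w \<Rightarrow> real^'c^'m) \<Rightarrow> real^'c::finite^'m::finite" where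
  "mat_expectation M V = (\<chi> i j. \<integral>\<omega>. V \<omega> $ i $ j \<partial>M)"

definition covariance :: "'w measure \<Rightarrow> ('w \<Rightarrow> real) \<Rightarrow> ('w \<Rightarrow> real) \<Rightarrow> real" where
  "covariance M a b = (\<integral>\<omega>. a \<omega> * b \<omega> \<partial>M) - (\<integral>\<omega>. a \<omega> \<partial>M) * (\<integral>\<omega>. b \<omega> \<partial>M)"

end

(* By the chain rule, each entry of the derivative of the composite loss is the dot product of the
   row gradient of the loss with the column of partial derivatives of the minimizer. Expanding the
   dot product and using E[ab] = E[a] E[b] + Cov[a,b] in each coordinate, the two sides of the
   stated condition are exactly the (i,j) entries of the true and of the expected derivative. *)

theory Submission
  imports Defs
begin

text \<open>Chain rule along the line \<open>t \<mapsto> x + t *\<^sub>R b\<close>, whose velocity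
  is \<open>b\<close>. It gives access to \<open>partial_deriv\<close>, defined by a choice
  operator, through the total derivative.\<close>

lemma partial_deriv_eq:
  assumes "(f has_derivative f') (at x)"
  shows "partial_deriv f x b = f' b"
proof -
  \<comment> \<open>Writing the base point as \<open>x + 0 *\<^sub>R b\<close> and restricting to
    the image of the line matches the premise of \<open>has_derivative_in_compose\<close>.\<close>
  have f: "(f has_derivative f') (at (x + 0 *\<^sub>R b) within range (\<lambda>t. x + t *\<^sub>R b))"
    using assms by (simp add: has_derivative_at_withinI)
  have "((\<lambda>t. x + t *\<^sub>R b) has_derivative (\<lambda>t. t *\<^sub>R b)) (at 0)"
    by (auto intro!: derivative_eq_intros)
  from has_derivative_in_compose[OF this f]
  have "((\<lambda>t. f (x + t *\<^sub>R b)) has_derivative (\<lambda>t. f' (t *\<^sub>R b))) (at 0)" .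
  moreover have "f' (t *\<^sub>R b) = t *\<^sub>R f' b" for t
    using assms by (simp add: has_derivative_linear linear_cmul)
  ultimately show ?thesis
    unfolding partial_deriv_def
    by (simp add: has_vector_derivative_def vector_derivative_at)
qed

text \<open>A linear map is fixed by its values on the standard basis, and for the total derivative
  these values are the partial derivatives.\<close>

lemma row_gradient_inner:
  assumes "(f has_derivative f') (at x)"
  shows "row_gradient f x \<bullet> v = f' v"
proof -
  have lin: "linear f'"
    using assms by (rule has_derivative_linear)
  have "f' v = f' (\<Sum>k\<in>UNIV. v $ k *\<^sub>R axis k 1)"
    using basis_expansion[of v] by (simp add: scalar_mult_eq_scaleR)
  also have "\<dots> = (\<Sum>k\<in>UNIV. v $ k * f' (axis k 1))"
    by (simp add: linear_sum[OF lin] linear_cmul[OF lin])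
  finally show ?thesis
    by (simp add: row_gradient_def vec_partial_def partial_deriv_eq[OF assms] inner_vec_def
        mult.commute)
qed

text \<open>The composite has total derivative \<open>f' \<circ> g'\<close>; evaluated at the unit
  matrix of entry \<open>(i,j)\<close>, the inner factor is the column of partials of
  \<open>g\<close>, and \<open>f'\<close> acts on it as the row gradient.\<close>

lemma entry_partial_compose:
  assumes "g differentiable (at X)" and "f differentiable (at (g X))"
  shows "entry_partial (\<lambda>Y. f (g Y)) X i j = row_gradient f (g X) \<bullet> entry_partial g X i j"
proof -
  obtain g' f' where g: "(g has_derivative g') (at X)" and f: "(f has_derivative f') (at (g X))"
    using assms by (auto simp: differentiable_def)
  have "((\<lambda>Y. f (g Y)) has_derivative (\<lambda>h. f' (g' h))) (at X)"
    using has_derivative_compose[OF g f] .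
  then show ?thesis
    by (simp add: entry_partial_def partial_deriv_eq row_gradient_inner[OF f] partial_deriv_eq[OF g])
qed

text \<open>Integrability of the products lets the integral pass through the finite sum over
  coordinates; then E[ab] = E[a] E[b] + Cov[a,b] termwise, by the definition of
  \<open>covariance\<close>.\<close>

lemma integral_inner_eq_covariance:
  fixes V W :: "'w \<Rightarrow> real^'k::finite"
  assumes "\<And>k. integrable M (\<lambda>\<omega>. V \<omega> $ k * W \<omega> $ k)"
  shows "(\<integral>\<omega>. V \<omega> \<bullet> W \<omega> \<partial>M) =
    vec_expectation M V \<bullet> vec_expectation M W
    + (\<Sum>k\<in>UNIV. covariance M (\<lambda>\<omega>. V \<omega> $ k) (\<lambda>\<omega>. W \<omega> $ k))"
  using assms
  by (simp add: inner_vec_def vec_expectation_def covariance_def sum_subtractf)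

theorem theorem1:
  fixes D :: "'x measure"
    and loss :: "'x \<Rightarrow> real^'p::finite \<Rightarrow> (real^'c::finite) list \<Rightarrow> real"
    and Xt :: "real^'c^'n::{finite,linorder}"
    and Xs :: "real^'c^'m::{finite,linorder}"
    and M :: "'w measure"
    and \<zeta> :: "'r::finite \<Rightarrow> 'w \<Rightarrow> 'x"
    and \<theta>star :: "real^'c^'m::{finite,linorder} \<Rightarrow> real^'p"
    and \<theta>hat :: "('r \<Rightarrow> 'x) \<Rightarrow> real^'c^'m::{finite,linorder} \<Rightarrow> real^'p"
  defines "Lt \<equiv> \<lambda>\<theta>. ssl_loss D loss \<theta> (row_list Xt)"
    and "hat \<equiv> \<lambda>\<omega>. \<theta>hat (\<lambda>i. \<zeta> i \<omega>)"
  assumes "prob_space D"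
    and "prob_space M"
    and "\<And>i. \<zeta> i \<in> measurable M D"
    and "\<And>i. distr M D (\<zeta> i) = D"
    and "\<And>X. is_arg_min (\<lambda>\<theta>. ssl_loss D loss \<theta> (row_list X)) (\<lambda>_. True) (\<theta>star X)"
    and "\<And>\<omega> X. \<omega> \<in> space M \<Longrightarrow>
           is_arg_min (\<lambda>\<theta>. emp_loss (\<lambda>i. \<zeta> i \<omega>) loss \<theta> (row_list X)) (\<lambda>_. True) (hat \<omega> X)"
    and "Lt differentiable (at (\<theta>star Xs))"
    and "\<And>\<omega>. \<omega> \<in> space M \<Longrightarrow> Lt differentiable (at (hat \<omega> Xs))"
    and "\<theta>star differentiable (at Xs)"
    and "\<And>\<omega>. \<omega> \<in> space M \<Longrightarrow> hat \<omega> differentiable (at Xs)"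
    and "\<And>k. integrable M (\<lambda>\<omega>. vec_partial Lt (hat \<omega> Xs) k)"
    and "\<And>k i j. integrable M (\<lambda>\<omega>. entry_partial (hat \<omega>) Xs i j $ k)"
    and "\<And>k i j. integrable M
           (\<lambda>\<omega>. vec_partial Lt (hat \<omega> Xs) k * entry_partial (hat \<omega>) Xs i j $ k)"
    and "\<not> (\<forall>i j.
           row_gradient Lt (\<theta>star Xs) \<bullet> entry_partial \<theta>star Xs i j =
           vec_expectation M (\<lambda>\<omega>. row_gradient Lt (hat \<omega> Xs))
             \<bullet> vec_expectation M (\<lambda>\<omega>. entry_partial (hat \<omega>) Xs i j)
           + (\<Sum>k\<in>UNIV. covariance M (\<lambda>\<omega>. vec_partial Lt (hat \<omega> Xs) k)
                                      (\<lambda>\<omega>. entry_partial (hat \<omega>) Xs i j $ k)))"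
  shows "mat_expectation M (\<lambda>\<omega>. mat_gradient (\<lambda>X. Lt (hat \<omega> X)) Xs)
         \<noteq> mat_gradient (\<lambda>X. Lt (\<theta>star X)) Xs"
proof
  \<comment> \<open>Contraposition: equal matrices agree in every entry, which forces the stated
    condition for all pairs \<open>i j\<close>.\<close>
  assume eq: "mat_expectation M (\<lambda>\<omega>. mat_gradient (\<lambda>X. Lt (hat \<omega> X)) Xs)
    = mat_gradient (\<lambda>X. Lt (\<theta>star X)) Xs"
  have "row_gradient Lt (\<theta>star Xs) \<bullet> entry_partial \<theta>star Xs i j =
      vec_expectation M (\<lambda>\<omega>. row_gradient Lt (hat \<omega> Xs))
        \<bullet> vec_expectation M (\<lambda>\<omega>. entry_partial (hat \<omega>) Xs i j)
      + (\<Sum>k\<in>UNIV. covariance M (\<lambda>\<omega>. vec_partial Lt (hat \<omega> Xs) k)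
                                 (\<lambda>\<omega>. entry_partial (hat \<omega>) Xs i j $ k))" for i j
  proof -
    have "row_gradient Lt (\<theta>star Xs) \<bullet> entry_partial \<theta>star Xs i j
        = mat_gradient (\<lambda>X. Lt (\<theta>star X)) Xs $ i $ j"
      using entry_partial_compose[OF \<open>\<theta>star differentiable (at Xs)\<close>
          \<open>Lt differentiable (at (\<theta>star Xs))\<close>]
      by (simp add: mat_gradient_def)
    \<comment> \<open>The assumed equality enters here, read from right to left at entry
      \<open>(i,j)\<close>.\<close>
    also have "\<dots> = (\<integral>\<omega>. entry_partial (\<lambda>X. Lt (hat \<omega> X)) Xs i j \<partial>M)"
      unfolding eq[symmetric] by (simp add: mat_expectation_def mat_gradient_def)
    \<comment> \<open>The chain rule is applied separately for each realization; differentiability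
      is given on \<open>space M\<close>, which suffices for equality of the integrals.\<close>
    also have "\<dots> = (\<integral>\<omega>. row_gradient Lt (hat \<omega> Xs) \<bullet> entry_partial (hat \<omega>) Xs i j \<partial>M)"
      using \<open>\<And>\<omega>. \<omega> \<in> space M \<Longrightarrow> hat \<omega> differentiable (at Xs)\<close>
        \<open>\<And>\<omega>. \<omega> \<in> space M \<Longrightarrow> Lt differentiable (at (hat \<omega> Xs))\<close>
      by (intro Bochner_Integration.integral_cong refl entry_partial_compose)
    also have "\<dots> = vec_expectation M (\<lambda>\<omega>. row_gradient Lt (hat \<omega> Xs))
        \<bullet> vec_expectation M (\<lambda>\<omega>. entry_partial (hat \<omega>) Xs i j)
      + (\<Sum>k\<in>UNIV. covariance M (\<lambda>\<omega>. row_gradient Lt (hat \<omega> Xs) $ k)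
                                 (\<lambda>\<omega>. entry_partial (hat \<omega>) Xs i j $ k))"
      \<comment> \<open>\<open>assms(15)\<close> is the integrability of the coordinatewise products
        of loss partials and minimizer partials.\<close>
      using assms(15) by (intro integral_inner_eq_covariance) (simp add: row_gradient_def)
    finally show ?thesis
      by (simp add: row_gradient_def)
  qed
  then show False
    using assms(16) by blast
qed

end
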